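(* Let $X$ and $Y$ be Banach spaces, $U\subset X$ an open set and $T:Y\to X$ a bounded linear operator. Then $T$ is compact if and only if for every Banach space $Z$ and every locally Lipschitz function $f:U\to Z$, $f\circ T$ is Fréchet differentiable at $y\in Y$ whenever $f$ is Gâteaux differentiable at $Ty\in U$.
   Context: The composition $f\circ T$ is defined on the open set $T^{-1}(U)$. A function $f:U\subset X\to Z$ is locally Lipschitz if for every $u\in U$ there exist constants $r,L>0$ such that $\|f(x)-f(y)\|\le L\|x-y\|$ for all $x,y\in U\cap B(u,r)$, where $B(u,r)$ is the open ball of center $u$ and radius $r$. Gâteaux differentiability of $f$ at $x$ means that there is a bounded linear operator $d_Gf(x):X\to Z$ with $\lim_{t\to0}\frac{f(x+th)-f(x)}{t}=d_Gf(x)h$ for each $h\in X$. Fréchet differentiability means that this limit is uniform for $h$ in the unit ball.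
   Formalization: The formal theorem additionally assumes that T^{-1}(U) is nonempty; otherwise the differentiability condition is vacuous and the equivalence fails for noncompact T (e.g. U empty). *)

theory Defs
  imports "HOL-Analysis.Analysis" "HOL-Algebra.Module"
begin

text \<open>
  The space \<open>Z\<close> is quantified inside a formula, which a type class does not allow.  It is therefore
  a carrier-based structure: a \<open>\<real>\<close>-module in the sense of HOL-Algebra (the ring fields \<open>mult\<close> and
  \<open>one\<close> of the record are irrelevant) with a norm, whose carrier is an arbitrary subset of a type.
\<close>

definition real_ring :: "real ring" where
  "real_ring = \<lparr>carrier = UNIV, mult = (*), one = 1, zero = 0, add = (+)\<rparr>"

record 'z normed_structure = "(real, 'z) module" +
  vnorm :: "'z \<Rightarrow> real"

locale normed_vector_space = module real_ring Z
  for Z :: "'z normed_structure" (structure) +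
  assumes vnorm_eq_0_iff: "x \<in> carrier Z \<Longrightarrow> vnorm Z x = 0 \<longleftrightarrow> x = \<zero>"
    and vnorm_triangle:
      "x \<in> carrier Z \<Longrightarrow> y \<in> carrier Z \<Longrightarrow> vnorm Z (x \<oplus> y) \<le> vnorm Z x + vnorm Z y"
    and vnorm_smult: "x \<in> carrier Z \<Longrightarrow> vnorm Z (r \<odot> x) = \<bar>r\<bar> * vnorm Z x"

locale banach_space = normed_vector_space +
  assumes complete: "Metric_space.mcomplete (carrier Z) (\<lambda>x y. vnorm Z (x \<ominus> y))"

definition bounded_linear_into ::
  "'z normed_structure \<Rightarrow> ('a::real_normed_vector \<Rightarrow> 'z) \<Rightarrow> bool" where
  "bounded_linear_into Z L \<longleftrightarrow>
     (\<forall>h. L h \<in> carrier Z) \<and>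
     (\<forall>h k. L (h + k) = L h \<oplus>\<^bsub>Z\<^esub> L k) \<and>
     (\<forall>r h. L (r *\<^sub>R h) = r \<odot>\<^bsub>Z\<^esub> L h) \<and>
     (\<exists>K. \<forall>h. vnorm Z (L h) \<le> K * norm h)"

definition locally_lipschitz ::
  "'z normed_structure \<Rightarrow> 'a::real_normed_vector set \<Rightarrow> ('a \<Rightarrow> 'z) \<Rightarrow> bool" where
  "locally_lipschitz Z U f \<longleftrightarrow>
     (\<forall>u\<in>U. \<exists>r>0. \<exists>L>0. \<forall>x\<in>U \<inter> ball u r. \<forall>y\<in>U \<inter> ball u r.
        vnorm Z (f x \<ominus>\<^bsub>Z\<^esub> f y) \<le> L * norm (x - y))"

text \<open>
  Differentiability is only meant at interior points \<open>x\<close> of the domain of \<open>f\<close>.  There the limits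
  \<open>t \<rightarrow> 0\<close> do not depend on the values of the total function \<open>f\<close> outside its domain.
\<close>

definition diff_quotient ::
  "'z normed_structure \<Rightarrow> ('a::real_normed_vector \<Rightarrow> 'z) \<Rightarrow> 'a \<Rightarrow> 'a \<Rightarrow> real \<Rightarrow> 'z" where
  "diff_quotient Z f x h t = (1 / t) \<odot>\<^bsub>Z\<^esub> (f (x + t *\<^sub>R h) \<ominus>\<^bsub>Z\<^esub> f x)"

definition gateaux_differentiable_at ::
  "'z normed_structure \<Rightarrow> ('a::real_normed_vector \<Rightarrow> 'z) \<Rightarrow> 'a \<Rightarrow> bool" where
  "gateaux_differentiable_at Z f x \<longleftrightarrow>
     (\<exists>L. bounded_linear_into Z L \<and>
        (\<forall>h. \<forall>e>0. \<forall>\<^sub>F t in at 0. vnorm Z (diff_quotient Z f x h t \<ominus>\<^bsub>Z\<^esub> L h) < e))"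

definition frechet_differentiable_at ::
  "'z normed_structure \<Rightarrow> ('a::real_normed_vector \<Rightarrow> 'z) \<Rightarrow> 'a \<Rightarrow> bool" where
  "frechet_differentiable_at Z f x \<longleftrightarrow>
     (\<exists>L. bounded_linear_into Z L \<and>
        (\<forall>e>0. \<forall>\<^sub>F t in at 0. \<forall>h\<in>cball 0 1.
           vnorm Z (diff_quotient Z f x h t \<ominus>\<^bsub>Z\<^esub> L h) < e))"

definition compact_operator ::
  "('a::real_normed_vector \<Rightarrow> 'b::real_normed_vector) \<Rightarrow> bool" where
  "compact_operator T \<longleftrightarrow> bounded_linear T \<and> compact (closure (T ` cball 0 1))"

end

theory Submission
  imports Defs
begin

text \<open>
  If \<open>T\<close> is compact, then the difference quotients of \<open>f\<close> at \<open>T y\<close> are equi-Lipschitz in the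
  direction, so their pointwise convergence is uniform on the compact closure of the image of the
  unit ball.

  If \<open>T\<close> is not compact, there are \<open>h\<^sub>n\<close> in the unit ball such that the points \<open>s\<^sub>n = T h\<^sub>n\<close> are
  \<open>4c\<close>-separated and of norm at least \<open>4c\<close>.  Let \<open>g\<close> be the distance to the complement of the union
  of the balls with center \<open>s\<^sub>n / (n + 1)\<close> and radius \<open>c / (n + 1)\<close>.  A line through the origin meets
  only finitely many of these balls, since the corresponding points of the line, rescaled, are
  \<open>2c\<close>-separated in a compact segment; so \<open>g\<close> vanishes near \<open>0\<close> on every line, and its Gateaux
  derivative there is \<open>0\<close>.  But \<open>g (s\<^sub>n / (n + 1)) \<ge> c / (n + 1)\<close>, so the difference quotients of
  \<open>g \<circ> T\<close> do not tend to \<open>0\<close> uniformly on the unit ball.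
\<close>

section \<open>Arithmetic in normed real modules\<close>

lemma real_ring_simps [simp]:
  "carrier real_ring = UNIV" "add real_ring = (+)" "mult real_ring = (*)"
  "one real_ring = 1" "zero real_ring = 0"
  by (simp_all add: real_ring_def)

lemma cring_real_ring: "cring real_ring"
proof (rule cringI)
  show "abelian_group real_ring"
    by (rule abelian_groupI) (auto intro: exI[of _ "- x" for x])
  show "comm_monoid real_ring"
    by (rule comm_monoidI) auto
qed (auto simp: algebra_simps)

context normed_vector_space
begin

lemma vnorm_minus_triangle:
  assumes "x \<in> carrier Z" "y \<in> carrier Z" "z \<in> carrier Z"
  shows "vnorm Z (x \<ominus> z) \<le> vnorm Z (x \<ominus> y) + vnorm Z (y \<ominus> z)"
proof -
  have "x \<ominus> z = (x \<ominus> y) \<oplus> (y \<ominus> z)"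
    using assms by (simp add: a_minus_def a_assoc r_neg1)
  then show ?thesis
    using assms vnorm_triangle[of "x \<ominus> y" "y \<ominus> z"] by simp
qed

lemma smult_diff:
  assumes "x \<in> carrier Z" "y \<in> carrier Z"
  shows "r \<odot> (x \<ominus> y) = r \<odot> x \<ominus> r \<odot> y"
  using assms by (simp add: a_minus_def smult_r_distr smult_r_minus)

lemma minus_minus_cancel:
  assumes "x \<in> carrier Z" "y \<in> carrier Z" "z \<in> carrier Z"
  shows "(x \<ominus> z) \<ominus> (y \<ominus> z) = x \<ominus> y"
  using assms a_lcomm[of z "\<ominus> y" "\<ominus> z"] by (simp add: a_minus_def minus_add a_ac r_neg)

lemma bounded_linear_into_diff:
  assumes "bounded_linear_into Z L"
  shows "L h \<ominus> L k = L (h - k)"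
proof -
  have c: "\<And>h. L h \<in> carrier Z"
    and add: "\<And>h k. L (h + k) = L h \<oplus> L k"
    using assms by (auto simp: bounded_linear_into_def)
  have "L h = L (h - k) \<oplus> L k"
    using add[of "h - k" k] by simp
  then show ?thesis
    using c by (simp add: a_minus_def a_assoc r_neg)
qed

text \<open>The terms \<open>f x\<close> cancel, and the factor \<open>1 / t\<close> cancels the
  \<open>t\<close> in the displacement, so a Lipschitz bound for \<open>f\<close> passes to the
  direction variable with a constant independent of \<open>t\<close>.\<close>

lemma diff_quotient_lipschitz:
  assumes "t \<noteq> 0" "f x \<in> carrier Z" "f (x + t *\<^sub>R h) \<in> carrier Z" "f (x + t *\<^sub>R k) \<in> carrier Z"
    and "vnorm Z (f (x + t *\<^sub>R h) \<ominus> f (x + t *\<^sub>R k)) \<le> C * norm ((x + t *\<^sub>R h) - (x + t *\<^sub>R k))"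
  shows "vnorm Z (diff_quotient Z f x h t \<ominus> diff_quotient Z f x k t) \<le> C * norm (h - k)"
proof -
  have "diff_quotient Z f x h t \<ominus> diff_quotient Z f x k t
      = (1 / t) \<odot> (f (x + t *\<^sub>R h) \<ominus> f (x + t *\<^sub>R k))"
    using assms(2-4) unfolding diff_quotient_def
    by (simp flip: smult_diff add: minus_minus_cancel)
  then have "vnorm Z (diff_quotient Z f x h t \<ominus> diff_quotient Z f x k t)
      = vnorm Z (f (x + t *\<^sub>R h) \<ominus> f (x + t *\<^sub>R k)) / \<bar>t\<bar>"
    using assms(2-4) by (simp add: vnorm_smult)
  also have "\<dots> \<le> C * norm (t *\<^sub>R (h - k)) / \<bar>t\<bar>"
    using assms(5) by (intro divide_right_mono) (auto simp: scaleR_diff_right)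
  finally show ?thesis using \<open>t \<noteq> 0\<close> by simp
qed

section \<open>Compact operators: from pointwise to uniform limits\<close>

text \<open>Equicontinuity in the direction: for small \<open>t\<close> the quotients share the
  Lipschitz constant \<open>C\<close> on \<open>K\<close>, and \<open>L\<close> is Lipschitz too, so
  convergence on a finite net of \<open>K\<close> controls all of \<open>K\<close>.\<close>

lemma gateaux_imp_uniform_on_compact:
  fixes f :: "'x::real_normed_vector \<Rightarrow> 'z"
  assumes "open U" "f \<in> U \<rightarrow> carrier Z" "locally_lipschitz Z U f" "x \<in> U"
    and L: "bounded_linear_into Z L"
    and lim: "\<And>h e. e > 0 \<Longrightarrow> \<forall>\<^sub>F t in at 0. vnorm Z (diff_quotient Z f x h t \<ominus> L h) < e"
    and K: "compact K" and "e > 0"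
  shows "\<forall>\<^sub>F t in at 0. \<forall>h\<in>K. vnorm Z (diff_quotient Z f x h t \<ominus> L h) < e"
proof -
  obtain r1 C where r1: "r1 > 0" "C > 0"
    and lip: "\<And>u v. u \<in> U \<inter> ball x r1 \<Longrightarrow> v \<in> U \<inter> ball x r1 \<Longrightarrow>
        vnorm Z (f u \<ominus> f v) \<le> C * norm (u - v)"
    using assms(3,4) unfolding locally_lipschitz_def by meson
  obtain r2 where r2: "r2 > 0" "ball x r2 \<subseteq> U"
    using assms(1,4) open_contains_ball by blast
  define r where "r = min r1 r2"
  have r: "r > 0" "ball x r \<subseteq> U \<inter> ball x r1"
    using r1 r2 by (auto simp: r_def)
  have Lc: "\<And>h. L h \<in> carrier Z"
    using L by (auto simp: bounded_linear_into_def)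
  obtain D where D: "\<And>h. vnorm Z (L h) \<le> D * norm h"
    using L by (auto simp: bounded_linear_into_def)
  \<comment> \<open>The bound \<open>D\<close> is not known to be nonnegative; its absolute value
    allows monotone estimates and makes \<open>C + \<bar>D\<bar>\<close> positive.\<close>
  have D': "vnorm Z (L h) \<le> \<bar>D\<bar> * norm h" for h
    by (rule order_trans[OF D mult_right_mono]) auto
  \<comment> \<open>Moving \<open>h\<close> to a net point at distance below \<open>d\<close> costs
    at most \<open>(C + \<bar>D\<bar>) * d = e / 2\<close>; the other half is spent at the net
    points.\<close>
  define d where "d = e / 2 / (C + \<bar>D\<bar>)"
  have CD: "C + \<bar>D\<bar> > 0" using r1 by simp
  have d: "d > 0" using CD \<open>e > 0\<close> by (simp add: d_def)
  obtain N where N: "finite N" "N \<subseteq> K" "K \<subseteq> (\<Union>k\<in>N. ball k d)"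
    using seq_compact_imp_totally_bounded[of K] K d by (metis compact_eq_seq_compact_metric)
  obtain M where M: "M > 0" "\<And>h. h \<in> K \<Longrightarrow> norm h \<le> M"
    using compact_imp_bounded[OF K] by (auto simp: bounded_pos)
  have ev1: "\<forall>\<^sub>F t in at 0. \<forall>k\<in>N. vnorm Z (diff_quotient Z f x k t \<ominus> L k) < e / 2"
    using N(1) \<open>e > 0\<close> by (intro eventually_ball_finite ballI lim) auto
  \<comment> \<open>Since \<open>M\<close> bounds the norms on \<open>K\<close>, this keeps
    \<open>x + t *\<^sub>R u\<close> in the ball of radius \<open>r\<close> for all \<open>u\<close>
    in \<open>K\<close> at once.\<close>
  have ev2: "\<forall>\<^sub>F t in at (0::real). \<bar>t\<bar> < r / M \<and> t \<noteq> 0"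
    using r(1) M(1) unfolding eventually_at
    by (intro exI[of _ "r / M"]) (auto simp: dist_real_def)
  from ev1 ev2 show ?thesis
  proof eventually_elim
    case (elim t)
    show ?case
    proof
      fix h assume "h \<in> K"
      then obtain k where k: "k \<in> N" "norm (k - h) < d"
        using N by (auto simp: dist_norm)
      have inball: "x + t *\<^sub>R u \<in> ball x r" if "u \<in> K" for u
      proof -
        have "\<bar>t\<bar> * norm u \<le> \<bar>t\<bar> * M" using M(2)[OF that] by (intro mult_left_mono) auto
        also have "\<dots> < r" using elim M(1) by (simp add: field_simps)
        finally show ?thesis by (simp add: dist_norm)
      qed
      have kK: "k \<in> K" using k N by auto
      have fc: "f x \<in> carrier Z" "f (x + t *\<^sub>R h) \<in> carrier Z" "f (x + t *\<^sub>R k) \<in> carrier Z"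
        using inball[OF \<open>h \<in> K\<close>] inball[OF kK] r assms(2,4) by (auto simp: Pi_iff)
      have qc: "diff_quotient Z f x h t \<in> carrier Z" "diff_quotient Z f x k t \<in> carrier Z"
        using fc by (auto simp: diff_quotient_def)
      have 1: "vnorm Z (diff_quotient Z f x h t \<ominus> diff_quotient Z f x k t) \<le> C * norm (h - k)"
        using elim fc inball[OF \<open>h \<in> K\<close>] inball[OF kK] r
        by (intro diff_quotient_lipschitz lip) auto
      have 2: "vnorm Z (L k \<ominus> L h) \<le> \<bar>D\<bar> * norm (k - h)"
        using D'[of "k - h"] by (simp add: bounded_linear_into_diff[OF L])
      have "vnorm Z (diff_quotient Z f x h t \<ominus> L h)
          \<le> vnorm Z (diff_quotient Z f x h t \<ominus> diff_quotient Z f x k t)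
            + vnorm Z (diff_quotient Z f x k t \<ominus> L h)"
        using qc Lc by (intro vnorm_minus_triangle) auto
      also have "vnorm Z (diff_quotient Z f x k t \<ominus> L h)
          \<le> vnorm Z (diff_quotient Z f x k t \<ominus> L k) + vnorm Z (L k \<ominus> L h)"
        using qc Lc by (intro vnorm_minus_triangle) auto
      also have "vnorm Z (diff_quotient Z f x h t \<ominus> diff_quotient Z f x k t)
            + (vnorm Z (diff_quotient Z f x k t \<ominus> L k) + vnorm Z (L k \<ominus> L h))
          < (C + \<bar>D\<bar>) * norm (k - h) + e / 2"
        using 1 2 elim k(1) by (fastforce simp: algebra_simps norm_minus_commute)
      also have "(C + \<bar>D\<bar>) * norm (k - h) \<le> (C + \<bar>D\<bar>) * d"
        using k CD by (intro mult_left_mono) auto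
      also have "(C + \<bar>D\<bar>) * d = e / 2"
        using CD unfolding d_def
        by (subst times_divide_eq_right, intro nonzero_mult_div_cancel_left) linarith
      finally show "vnorm Z (diff_quotient Z f x h t \<ominus> L h) < e" by simp
    qed
  qed
qed

text \<open>The quotient of \<open>f \<circ> T\<close> in direction \<open>h\<close> is that of
  \<open>f\<close> in direction \<open>T h\<close>. Hence \<open>L \<circ> T\<close> serves as
  derivative, with uniformity taken from the compact closure of the image of the unit ball.\<close>

lemma compact_operator_imp_frechet:
  fixes T :: "'y::real_normed_vector \<Rightarrow> 'x::real_normed_vector"
  assumes T: "compact_operator T"
    and U: "open U" "f \<in> U \<rightarrow> carrier Z" "locally_lipschitz Z U f" "T y \<in> U"
    and G: "gateaux_differentiable_at Z f (T y)"
  shows "frechet_differentiable_at Z (f \<circ> T) y"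
proof -
  interpret T: bounded_linear T using T by (simp add: compact_operator_def)
  obtain L where L: "bounded_linear_into Z L"
    and lim: "\<And>h e. e > 0 \<Longrightarrow>
        \<forall>\<^sub>F t in at 0. vnorm Z (diff_quotient Z f (T y) h t \<ominus> L h) < e"
    using G unfolding gateaux_differentiable_at_def by blast
  have quot: "diff_quotient Z (f \<circ> T) y h t = diff_quotient Z f (T y) (T h) t" for h t
    by (simp add: diff_quotient_def T.add T.scaleR)
  have LT: "bounded_linear_into Z (L \<circ> T)"
  proof -
    obtain D where D: "\<And>h. vnorm Z (L h) \<le> D * norm h"
      using L by (auto simp: bounded_linear_into_def)
    obtain B where B: "\<And>h. norm (T h) \<le> norm h * B"
      using T.bounded by blast
    have "vnorm Z (L (T h)) \<le> \<bar>D\<bar> * B * norm h" for h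
    proof -
      have "vnorm Z (L (T h)) \<le> \<bar>D\<bar> * norm (T h)"
        by (rule order_trans[OF D mult_right_mono]) auto
      also have "\<dots> \<le> \<bar>D\<bar> * (norm h * B)"
        by (intro mult_left_mono B) auto
      finally show ?thesis by (simp add: mult_ac)
    qed
    then show ?thesis
      using L by (auto simp: bounded_linear_into_def T.add T.scaleR)
  qed
  have K: "compact (closure (T ` cball 0 1))"
    using T by (simp add: compact_operator_def)
  have "\<forall>\<^sub>F t in at 0. \<forall>h\<in>cball 0 1.
      vnorm Z (diff_quotient Z (f \<circ> T) y h t \<ominus> (L \<circ> T) h) < e" if "e > 0" for e
  proof -
    have "\<forall>\<^sub>F t in at 0. \<forall>h\<in>closure (T ` cball 0 1).
        vnorm Z (diff_quotient Z f (T y) h t \<ominus> L h) < e"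
      using lim by (rule gateaux_imp_uniform_on_compact[OF U L _ K that])
    then show ?thesis
    proof eventually_elim
      case (elim t)
      then show ?case
        using closure_subset[of "T ` cball 0 1"] by (auto simp: quot)
    qed
  qed
  with LT show ?thesis
    unfolding frechet_differentiable_at_def by blast
qed

end

section \<open>The real line inside the type \<open>'z\<close>\<close>

text \<open>The counterexample is real valued, but its target must live in the abstract type
  \<open>'z\<close>; the structure of the line is therefore transported along an injection
  \<open>\<phi>\<close>.\<close>

definition real_copy :: "(real \<Rightarrow> 'z) \<Rightarrow> 'z normed_structure" where
  "real_copy \<phi> = \<lparr>carrier = range \<phi>, mult = (\<lambda>_ _. \<phi> 0), one = \<phi> 0, zero = \<phi> 0,
     add = (\<lambda>a b. \<phi> (inv_into UNIV \<phi> a + inv_into UNIV \<phi> b)), smult = (\<lambda>r a. \<phi> (r * inv_into UNIV \<phi> a)),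
     vnorm = (\<lambda>a. \<bar>inv_into UNIV \<phi> a\<bar>)\<rparr>"

lemma real_copy_simps [simp]:
  "carrier (real_copy \<phi>) = range \<phi>" "zero (real_copy \<phi>) = \<phi> 0"
  "add (real_copy \<phi>) a b = \<phi> (inv_into UNIV \<phi> a + inv_into UNIV \<phi> b)"
  "smult (real_copy \<phi>) r a = \<phi> (r * inv_into UNIV \<phi> a)"
  "vnorm (real_copy \<phi>) a = \<bar>inv_into UNIV \<phi> a\<bar>"
  by (simp_all add: real_copy_def)

(* This also covers arguments outside the carrier, where Metric_space still requires the distance
   to be nonnegative and symmetric. *)
lemma real_copy_minus [simp]:
  assumes "inj \<phi>"
  shows "a_minus (real_copy \<phi>) a b = \<phi> (inv_into UNIV \<phi> a - inv_into UNIV \<phi> b)"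
proof -
  have "a_inv (real_copy \<phi>) b = \<phi> (- inv_into UNIV \<phi> b)"
    unfolding a_inv_def m_inv_def
  proof (rule the_equality)
    fix z assume z: "z \<in> carrier (add_monoid (real_copy \<phi>)) \<and>
      mult (add_monoid (real_copy \<phi>)) b z = one (add_monoid (real_copy \<phi>)) \<and>
      mult (add_monoid (real_copy \<phi>)) z b = one (add_monoid (real_copy \<phi>))"
    then obtain u where "z = \<phi> u" by auto
    with z assms have "u + inv_into UNIV \<phi> b = 0" by (simp add: inj_eq)
    then have "u = - inv_into UNIV \<phi> b" by linarith
    with \<open>z = \<phi> u\<close> show "z = \<phi> (- inv_into UNIV \<phi> b)" by simp
  qed (use assms in simp)
  then show ?thesis using assms by (simp add: a_minus_def)
qed

lemma module_real_copy:
  assumes "inj \<phi>"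
  shows "module real_ring (real_copy \<phi>)"
proof (rule moduleI)
  show "cring real_ring" by (rule cring_real_ring)
  show "abelian_group (real_copy \<phi>)"
  proof (rule abelian_groupI)
    fix x assume "x \<in> carrier (real_copy \<phi>)"
    then show "\<exists>y\<in>carrier (real_copy \<phi>). add (real_copy \<phi>) y x = zero (real_copy \<phi>)"
      using assms by (intro bexI[of _ "\<phi> (- inv_into UNIV \<phi> x)"]) auto
  qed (use assms in \<open>auto simp: algebra_simps\<close>)
qed (use assms in \<open>auto simp: algebra_simps\<close>)

text \<open>\<open>\<phi>\<close> is an isometry of the real line onto the carrier, so limits of
  Cauchy sequences are found in the reals and mapped back.\<close>

lemma banach_space_real_copy:
  assumes "inj \<phi>"
  shows "banach_space (real_copy \<phi>)"
proof -
  interpret module real_ring "real_copy \<phi>" by (rule module_real_copy[OF assms])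
  interpret normed_vector_space "real_copy \<phi>"
    by unfold_locales (use assms in \<open>auto simp: inj_eq abs_mult\<close>)
  define d where "d = (\<lambda>x y. vnorm (real_copy \<phi>) (a_minus (real_copy \<phi>) x y))"
  have d: "d x y = \<bar>inv_into UNIV \<phi> x - inv_into UNIV \<phi> y\<bar>" for x y
    using assms by (simp add: d_def)
  interpret M: Metric_space "range \<phi>" d
    by unfold_locales (use assms in \<open>auto simp: d inj_eq\<close>)
  have "M.mcomplete"
    unfolding M.mcomplete_def
  proof (intro allI impI)
    fix \<sigma> assume \<sigma>: "M.MCauchy \<sigma>"
    have "Cauchy (\<lambda>n. inv_into UNIV \<phi> (\<sigma> n))"
      using \<sigma> unfolding M.MCauchy_def Cauchy_def by (simp add: d dist_real_def)
    then obtain l where l: "(\<lambda>n. inv_into UNIV \<phi> (\<sigma> n)) \<longlonglongrightarrow> l"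
      by (auto simp: Cauchy_convergent_iff convergent_def)
    have "limitin M.mtopology \<sigma> (\<phi> l) sequentially"
      unfolding M.limitin_metric
    proof (intro conjI allI impI)
      fix e :: real assume "e > 0"
      then have "\<forall>\<^sub>F n in sequentially. dist (inv_into UNIV \<phi> (\<sigma> n)) l < e"
        using l tendstoD by blast
      then show "\<forall>\<^sub>F n in sequentially. \<sigma> n \<in> range \<phi> \<and> d (\<sigma> n) (\<phi> l) < e"
      proof eventually_elim
        case (elim n)
        then show ?case
          using \<sigma> assms by (auto simp: M.MCauchy_def d dist_real_def)
      qed
    qed auto
    then show "\<exists>x. limitin M.mtopology \<sigma> x sequentially" by blast
  qed
  then show ?thesis
    by unfold_locales (simp add: d_def)
qed

section \<open>Separated sequences and bump functions\<close>

text \<open>The closure is complete, so without compactness it is not totally bounded, and points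
  can be chosen greedily, each far from \<open>0\<close> and from all earlier ones.\<close>

lemma separated_sequence_if_not_compact:
  fixes S :: "'a::{real_normed_vector, complete_space} set"
  assumes "\<not> compact (closure S)"
  shows "\<exists>c>0. \<exists>s :: nat \<Rightarrow> 'a. (\<forall>n. s n \<in> S \<and> norm (s n) \<ge> c) \<and>
    (\<forall>m n. m \<noteq> n \<longrightarrow> dist (s m) (s n) \<ge> c)"
proof -
  have "complete (closure S)" by (simp add: complete_eq_closed)
  then obtain e where e: "e > 0"
    and nocov: "\<And>k. finite k \<Longrightarrow> \<not> closure S \<subseteq> (\<Union>x\<in>k. ball x e)"
    using assms unfolding compact_eq_totally_bounded by blast
  \<comment> \<open>Halving the radius allows closed balls: a finite union of them is closed, so if
    it covers \<open>S\<close> it covers the closure, and then so do the open balls of radius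
    \<open>e\<close>.\<close>
  have ex: "\<exists>x\<in>S. \<forall>y\<in>k. dist x y \<ge> e / 2" if k: "finite k" for k
  proof (rule ccontr)
    assume "\<not> ?thesis"
    then have "S \<subseteq> (\<Union>x\<in>k. cball x (e / 2))"
      by (force simp: dist_commute not_le)
    moreover have "closed (\<Union>x\<in>k. cball x (e / 2))"
      using k by (intro closed_UN) auto
    ultimately have "closure S \<subseteq> (\<Union>x\<in>k. cball x (e / 2))"
      by (rule closure_minimal)
    also have "\<dots> \<subseteq> (\<Union>x\<in>k. ball x e)"
      using e by (intro UN_mono) auto
    finally show False using nocov[OF k] by blast
  qed
  \<comment> \<open>Putting \<open>0\<close> among the points to avoid yields the lower bound on the
    norms.\<close>
  define Q where "Q = (\<lambda>x (n::nat) r. r \<in> S \<and> (\<forall>y\<in>insert 0 (x ` {..<n}). dist r y \<ge> e / 2))"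
  have "\<exists>x. \<forall>n. Q x n (x n)"
  proof (rule dependent_wellorder_choice)
    fix n :: nat and x
    show "\<exists>r. Q x n r"
      unfolding Q_def using ex[of "insert 0 (x ` {..<n})"] by auto
  qed (auto simp: Q_def)
  then obtain s where s: "\<And>n. Q s n (s n)" by blast
  have "dist (s m) (s n) \<ge> e / 2" if "m \<noteq> n" for m n
    using that s[of m] s[of n] by (cases m n rule: linorder_cases) (auto simp: Q_def dist_commute)
  with e s show ?thesis
    by (intro exI[of _ "e / 2"] exI[of _ s] conjI) (auto simp: Q_def)
qed

text \<open>The nearby points of the line stay in a compact segment; when it is covered by finitely
  many balls of radius \<open>c\<close>, different indices need different centers.\<close>

lemma finite_balls_meeting_line:
  fixes s :: "nat \<Rightarrow> 'a::real_normed_vector"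
  assumes "c > 0" and bdd: "\<And>n. norm (s n) \<le> M"
    and sep: "\<And>m n. m \<noteq> n \<Longrightarrow> dist (s m) (s n) \<ge> 4 * c"
  shows "finite {n. \<exists>a. dist (a *\<^sub>R h) (s n) < c}"
\<comment> \<open>For \<open>h = 0\<close> the line is the single point \<open>0\<close>, and the
  separation leaves room for at most one \<open>s n\<close> within \<open>c\<close> of it.\<close>
proof (cases "h = 0")
  case True
  have "m = n" if "norm (s m) < c" "norm (s n) < c" for m n
    using sep[of m n] dist_triangle2[of "s m" "s n" 0] that \<open>c > 0\<close> by fastforce
  then have "{n. norm (s n) < c} \<subseteq> {SOME n. norm (s n) < c}"
    by (metis (mono_tags, lifting) mem_Collect_eq singletonI someI subsetI)
  then show ?thesis using True finite_subset by auto
next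
  case False
  define J where "J = {n. \<exists>a. dist (a *\<^sub>R h) (s n) < c}"
  then have "\<forall>n\<in>J. \<exists>a. dist (a *\<^sub>R h) (s n) < c" by auto
  then obtain a where a: "\<And>n. n \<in> J \<Longrightarrow> dist (a n *\<^sub>R h) (s n) < c" by metis
  \<comment> \<open>A point of the line within \<open>c\<close> of some \<open>s n\<close> has norm
    below \<open>M + c\<close>, whence the radius.\<close>
  define K where "K = (\<lambda>t. t *\<^sub>R h) ` cball 0 ((M + c) / norm h)"
  have "compact K" unfolding K_def
    by (intro compact_continuous_image continuous_intros compact_cball)
  then obtain N where N: "finite N" "K \<subseteq> (\<Union>k\<in>N. ball k c)"
    using seq_compact_imp_totally_bounded[of K] \<open>c > 0\<close> by (metis compact_eq_seq_compact_metric)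
  have "a n *\<^sub>R h \<in> K" if "n \<in> J" for n
  proof -
    have "norm (a n *\<^sub>R h) \<le> norm (s n) + dist (a n *\<^sub>R h) (s n)"
      by (metis dist_norm norm_triangle_sub)
    then have "\<bar>a n\<bar> * norm h \<le> M + c" using a[OF that] bdd[of n] by simp
    then show ?thesis using False unfolding K_def
      by (intro imageI) (simp add: field_simps)
  qed
  then have "\<forall>n\<in>J. \<exists>k\<in>N. dist k (a n *\<^sub>R h) < c" using N(2) by fastforce
  then obtain k where k: "\<And>n. n \<in> J \<Longrightarrow> k n \<in> N" "\<And>n. n \<in> J \<Longrightarrow> dist (k n) (a n *\<^sub>R h) < c"
    by metis
  have "inj_on k J"
  proof (rule inj_onI, rule ccontr)
    fix m n assume mn: "m \<in> J" "n \<in> J" "k m = k n" "m \<noteq> n"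
    \<comment> \<open>A common center would join \<open>s m\<close> to \<open>s n\<close> through
      four distances below \<open>c\<close>, against the separation by \<open>4 * c\<close>.\<close>
    have "dist (s m) (s n) \<le> dist (a m *\<^sub>R h) (s m) + dist (k m) (a m *\<^sub>R h)
        + (dist (k n) (a n *\<^sub>R h) + dist (a n *\<^sub>R h) (s n))"
      using mn(3) dist_triangle[of "s m" "s n" "k m"] dist_triangle[of "s m" "k m" "a m *\<^sub>R h"]
        dist_triangle[of "k n" "s n" "a n *\<^sub>R h"] by (simp add: dist_commute)
    then show False
      using a[of m] a[of n] k(2)[of m] k(2)[of n] mn sep[of m n] by simp
  qed
  then have "finite J" using k(1) N(1) by (meson finite_subset finite_imageD image_subsetI)
  then show ?thesis by (simp add: J_def)
qed

text \<open>Center and radius shrink by the same factor \<open>1 / Suc n\<close>: the bumps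
  accumulate at \<open>0\<close>, yet their height stays comparable to the norm of their
  centers.\<close>

lemma lipschitz_bumps_along_separated_sequence:
  fixes s :: "nat \<Rightarrow> 'a::real_normed_vector"
  assumes "c > 0" and bdd: "\<And>n. norm (s n) \<le> M" and norm: "\<And>n. norm (s n) \<ge> 4 * c"
    and sep: "\<And>m n. m \<noteq> n \<Longrightarrow> dist (s m) (s n) \<ge> 4 * c"
  shows "\<exists>g :: 'a \<Rightarrow> real. (\<forall>x y. \<bar>g x - g y\<bar> \<le> norm (x - y)) \<and> g 0 = 0 \<and>
    (\<forall>h. \<forall>\<^sub>F t in at 0. g (t *\<^sub>R h) = 0) \<and> (\<forall>n. g ((1 / Suc n) *\<^sub>R s n) \<ge> c / Suc n)"
proof -
  define A where "A = - (\<Union>n. ball ((1 / Suc n) *\<^sub>R s n) (c / Suc n))"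
  define g where "g x = infdist x A" for x
  \<comment> \<open>The norm of the center, at least \<open>4 * c / Suc n\<close>, exceeds the
    radius by \<open>3 * c / Suc n\<close>; a smaller bound suffices.\<close>
  have far: "norm x \<ge> c / Suc n" if "x \<in> ball ((1 / Suc n) *\<^sub>R s n) (c / Suc n)" for x n
  proof -
    have "norm ((1 / Suc n) *\<^sub>R s n) \<le> norm x + dist ((1 / Suc n) *\<^sub>R s n) x"
      by (metis dist_norm norm_triangle_sub)
    moreover have "norm ((1 / Suc n) *\<^sub>R s n) \<ge> 4 * c / Suc n"
      using norm[of n] by (simp add: divide_right_mono)
    moreover have "4 * c / Suc n = 4 * (c / Suc n)" "c / Suc n > 0" using \<open>c > 0\<close> by auto
    ultimately show ?thesis using that by simp
  qed
  have A0: "0 \<in> A"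
  proof (rule ccontr)
    assume "0 \<notin> A"
    then obtain n where "0 \<in> ball ((1 / Suc n) *\<^sub>R s n) (c / Suc n)"
      unfolding A_def by blast
    from far[OF this] have "c / Suc n \<le> 0" by simp
    moreover have "c / Suc n > 0" using \<open>c > 0\<close> by simp
    ultimately show False by linarith
  qed
  show ?thesis
  proof (intro exI[of _ g] conjI allI)
    show "\<bar>g x - g y\<bar> \<le> norm (x - y)" for x y
      unfolding g_def by (metis infdist_triangle_abs dist_norm)
    show "g 0 = 0" using A0 by (simp add: g_def)
    show "\<forall>\<^sub>F t in at 0. g (t *\<^sub>R h) = 0" for h
    proof -
      let ?J = "{n. \<exists>a. dist (a *\<^sub>R h) (s n) < c}"
      have "((\<lambda>t. norm (t *\<^sub>R h)) \<longlongrightarrow> norm (0 *\<^sub>R h)) (at 0)"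
        by (intro tendsto_intros)
      then have lim: "((\<lambda>t. norm (t *\<^sub>R h)) \<longlongrightarrow> 0) (at 0)" by simp
      \<comment> \<open>Only the finitely many bumps that the line can meet matter; by
        \<open>far\<close> each of them stays away from \<open>0\<close>, so small \<open>t\<close>
        avoid them all.\<close>
      have "\<forall>\<^sub>F t in at 0. \<forall>n\<in>?J. norm (t *\<^sub>R h) < c / Suc n"
        using finite_balls_meeting_line[OF assms(1,2,4)] \<open>c > 0\<close>
        by (intro eventually_ball_finite ballI order_tendstoD[OF lim]) auto
      then show ?thesis
      proof eventually_elim
        case (elim t)
        have "t *\<^sub>R h \<in> A"
        proof (rule ccontr)
          assume "t *\<^sub>R h \<notin> A"
          then obtain n where n: "t *\<^sub>R h \<in> ball ((1 / Suc n) *\<^sub>R s n) (c / Suc n)"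
            unfolding A_def by blast
          \<comment> \<open>Multiplication by \<open>Suc n\<close> turns the \<open>n\<close>-th
            ball into the one with center \<open>s n\<close> and radius \<open>c\<close>, so the
            line meets the latter and \<open>n\<close> belongs to \<open>?J\<close>.\<close>
          have "t *\<^sub>R h - (1 / Suc n) *\<^sub>R s n = (1 / Suc n) *\<^sub>R ((Suc n * t) *\<^sub>R h - s n)"
            by (simp add: scaleR_diff_right del: of_nat_Suc)
          then have "dist (t *\<^sub>R h) ((1 / Suc n) *\<^sub>R s n) = dist ((Suc n * t) *\<^sub>R h) (s n) / Suc n"
            unfolding dist_norm by (simp del: of_nat_Suc)
          with n have "dist ((Suc n * t) *\<^sub>R h) (s n) < c"
            by (simp add: dist_commute divide_less_cancel del: of_nat_Suc)
          then have "n \<in> ?J" by blast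
          then show False using elim far[OF n] by fastforce
        qed
        then show ?case by (simp add: g_def)
      qed
    qed
    show "g ((1 / Suc n) *\<^sub>R s n) \<ge> c / Suc n" for n
    proof -
      \<comment> \<open>\<open>infdist\<close> to the empty set is \<open>0\<close> by convention,
        so nonemptiness is secured before passing to the infimum.\<close>
      have "A \<noteq> {}" using A0 by blast
      moreover have "c / Suc n \<le> dist ((1 / Suc n) *\<^sub>R s n) a" if "a \<in> A" for a
        using that unfolding A_def by (force simp: not_less)
      ultimately show ?thesis
        unfolding g_def infdist_def by (auto intro!: cINF_greatest)
    qed
  qed
qed

section \<open>Noncompact operators: the counterexample\<close>

text \<open>The bump function is moved to \<open>T y\<close> and read in the copy of the line. Its
  directional quotients vanish eventually, which forces a Frechet derivative of the composition to
  vanish on the unit ball, while the quotient in direction \<open>h n\<close> at step size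
  \<open>1 / Suc n\<close> is at least \<open>c\<close>.\<close>

lemma not_compact_operator_counterexample:
  fixes T :: "'y::real_normed_vector \<Rightarrow> 'x::banach"
  assumes T: "bounded_linear T" and nc: "\<not> compact_operator T" and \<phi>: "inj \<phi>"
  obtains f where "range f \<subseteq> range \<phi>" "locally_lipschitz (real_copy \<phi>) U f"
    "gateaux_differentiable_at (real_copy \<phi>) f (T y)"
    "\<not> frechet_differentiable_at (real_copy \<phi>) (f \<circ> T) y"
proof -
  interpret T: bounded_linear T by (rule T)
  have "\<not> compact (closure (T ` cball 0 1))"
    using assms by (simp add: compact_operator_def)
  then have "\<exists>c>0. \<exists>s :: nat \<Rightarrow> 'x. (\<forall>n. s n \<in> T ` cball 0 1 \<and> norm (s n) \<ge> c) \<and>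
      (\<forall>m n. m \<noteq> n \<longrightarrow> dist (s m) (s n) \<ge> c)"
    by (rule separated_sequence_if_not_compact)
  then obtain c' and s :: "nat \<Rightarrow> 'x" where s: "c' > 0" "\<forall>n. s n \<in> T ` cball 0 1 \<and> norm (s n) \<ge> c'"
    "\<forall>m n. m \<noteq> n \<longrightarrow> dist (s m) (s n) \<ge> c'"
    by auto
  \<comment> \<open>The bump construction asks for separation and norms of at least
    \<open>4 * c\<close>.\<close>
  define c where "c = c' / 4"
  have "\<forall>n. \<exists>h. h \<in> cball 0 1 \<and> s n = T h" using s(2) by blast
  then obtain h where h: "\<And>n. h n \<in> cball 0 1" "\<And>n. s n = T (h n)" by metis
  obtain B where B: "B > 0" "\<And>h. norm (T h) \<le> norm h * B"
    using T.pos_bounded by blast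
  have bdd: "norm (s n) \<le> B" for n
  proof -
    have "norm (T (h n)) \<le> norm (h n) * B" by (rule B)
    also have "\<dots> \<le> 1 * B" using h(1)[of n] B(1) by (intro mult_right_mono) auto
    finally show ?thesis by (simp add: h)
  qed
  have "\<exists>g :: 'x \<Rightarrow> real. (\<forall>x y. \<bar>g x - g y\<bar> \<le> norm (x - y)) \<and> g 0 = 0 \<and>
      (\<forall>h. \<forall>\<^sub>F t in at 0. g (t *\<^sub>R h) = 0) \<and> (\<forall>n. g ((1 / Suc n) *\<^sub>R s n) \<ge> c / Suc n)"
    using s bdd by (intro lipschitz_bumps_along_separated_sequence[of c s B]) (auto simp: c_def)
  then obtain g :: "'x \<Rightarrow> real" where g: "\<And>x y. \<bar>g x - g y\<bar> \<le> norm (x - y)" "g 0 = 0"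
    "\<And>h. \<forall>\<^sub>F t in at 0. g (t *\<^sub>R h) = 0"
    "\<And>n. g ((1 / Suc n) *\<^sub>R s n) \<ge> c / Suc n"
    by blast
  define f where "f x = \<phi> (g (x - T y))" for x
  have "c > 0" using s by (simp add: c_def)
  have quot: "inv_into UNIV \<phi> (diff_quotient (real_copy \<phi>) f (T y) k t) = g (t *\<^sub>R k) / t" for k t
    using \<phi> by (simp add: diff_quotient_def f_def g(2))
  have quotT: "diff_quotient (real_copy \<phi>) (f \<circ> T) y k t = diff_quotient (real_copy \<phi>) f (T y) (T k) t"
    for k t
    by (simp add: diff_quotient_def T.add T.scaleR)
  show thesis
  proof (rule that[of f])
    show "range f \<subseteq> range \<phi>" by (auto simp: f_def)
    have "\<bar>g (u - T y) - g (v - T y)\<bar> \<le> norm (u - v)" for u v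
      using g(1)[of "u - T y" "v - T y"] by simp
    then show "locally_lipschitz (real_copy \<phi>) U f"
      unfolding locally_lipschitz_def using \<phi>
      by (intro ballI exI[of _ 1] conjI) (auto simp: f_def)
    have "bounded_linear_into (real_copy \<phi>) (\<lambda>_::'x. \<phi> 0)"
      unfolding bounded_linear_into_def using \<phi> by (auto intro: exI[of _ 0])
    moreover have "\<forall>\<^sub>F t in at 0. vnorm (real_copy \<phi>)
        (a_minus (real_copy \<phi>) (diff_quotient (real_copy \<phi>) f (T y) k t) (\<phi> 0)) < e"
      if "e > 0" for e k
      using g(3)[of k] by eventually_elim (use that \<phi> in \<open>simp add: quot\<close>)
    ultimately show "gateaux_differentiable_at (real_copy \<phi>) f (T y)"
      unfolding gateaux_differentiable_at_def by blast
    show "\<not> frechet_differentiable_at (real_copy \<phi>) (f \<circ> T) y"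
    proof
      assume "frechet_differentiable_at (real_copy \<phi>) (f \<circ> T) y"
      then obtain L where "\<And>e. e > 0 \<Longrightarrow> \<forall>\<^sub>F t in at 0. \<forall>k\<in>cball 0 1. vnorm (real_copy \<phi>)
          (a_minus (real_copy \<phi>) (diff_quotient (real_copy \<phi>) (f \<circ> T) y k t) (L k)) < e"
        unfolding frechet_differentiable_at_def by blast
      then have L: "\<forall>\<^sub>F t in at 0. \<forall>k\<in>cball 0 1. \<bar>g (t *\<^sub>R T k) / t - inv_into UNIV \<phi> (L k)\<bar> < e"
        if "e > 0" for e
        using that \<phi> by (simp add: quotT quot)
      \<comment> \<open>With the size of the value at \<open>k\<close> as tolerance, the eventually
        zero quotients in direction \<open>k\<close> would make that size strictly smaller than
        itself.\<close>
      have L0: "inv_into UNIV \<phi> (L k) = 0" if k: "k \<in> cball 0 1" for k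
      proof (rule ccontr)
        assume "inv_into UNIV \<phi> (L k) \<noteq> 0"
        then have "\<forall>\<^sub>F t in at 0. \<forall>k'\<in>cball 0 1.
            \<bar>g (t *\<^sub>R T k') / t - inv_into UNIV \<phi> (L k')\<bar> < \<bar>inv_into UNIV \<phi> (L k)\<bar>"
          by (intro L) auto
        with g(3)[of "T k"] have "\<forall>\<^sub>F t in at (0::real). False"
          by eventually_elim (use k in fastforce)
        then show False by simp
      qed
      \<comment> \<open>Uniformity over the unit ball lets the direction change with the step size,
        so \<open>t = 1 / Suc n\<close> may be tested against \<open>h n\<close>.\<close>
      have "filterlim (\<lambda>n. 1 / real (Suc n)) (at 0) sequentially"
        unfolding filterlim_at using lim_1_over_n LIMSEQ_Suc[OF lim_1_over_n]
        by (auto simp del: of_nat_Suc)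
      with L[OF \<open>c > 0\<close>] have "\<forall>\<^sub>F n in sequentially. \<forall>k\<in>cball 0 1.
          \<bar>g ((1 / real (Suc n)) *\<^sub>R T k) / (1 / real (Suc n)) - inv_into UNIV \<phi> (L k)\<bar> < c"
        unfolding filterlim_iff by blast
      from eventually_happens'[OF sequentially_bot this] obtain n where n: "\<forall>k\<in>cball 0 1.
          \<bar>g ((1 / real (Suc n)) *\<^sub>R T k) / (1 / real (Suc n)) - inv_into UNIV \<phi> (L k)\<bar> < c"
        ..
      have "\<bar>g ((1 / real (Suc n)) *\<^sub>R s n) / (1 / real (Suc n))\<bar> < c"
        using bspec[OF n h(1)] by (simp only: L0[OF h(1)] diff_zero h(2))
      moreover have "g ((1 / real (Suc n)) *\<^sub>R s n) / (1 / real (Suc n)) \<ge> c"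
        using g(4)[of n] by (simp add: field_simps del: of_nat_Suc)
      ultimately show False by simp
    qed
  qed
qed

(* The type 'z is the universe from which the underlying sets of the spaces Z are taken; it must
   contain a copy of the reals, since a smaller one might only contain the zero space.
   If T -` U is empty, the differentiability condition is vacuous for every T. *)
theorem theorem3p1:
  fixes T :: "'y::banach \<Rightarrow> 'x::banach" and U :: "'x set"
  assumes "open U" and "T -` U \<noteq> {}"
    and "bounded_linear T"
    and "(UNIV :: real set) \<lesssim> (UNIV :: 'z set)"
  shows "compact_operator T \<longleftrightarrow>
    (\<forall>(Z :: 'z normed_structure) f.
       banach_space Z \<and> f \<in> U \<rightarrow> carrier Z \<and> locally_lipschitz Z U f \<longrightarrow>
       (\<forall>y. T y \<in> U \<and> gateaux_differentiable_at Z f (T y) \<longrightarrow>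
            frechet_differentiable_at Z (f \<circ> T) y))"
    (is "_ \<longleftrightarrow> ?R")
proof
  assume T: "compact_operator T"
  show ?R
  proof (intro allI impI, elim conjE)
    fix Z :: "'z normed_structure" and f y
    assume "banach_space Z" and f: "f \<in> U \<rightarrow> carrier Z" "locally_lipschitz Z U f"
      "T y \<in> U" "gateaux_differentiable_at Z f (T y)"
    then interpret banach_space Z by simp
    show "frechet_differentiable_at Z (f \<circ> T) y"
      by (rule compact_operator_imp_frechet[OF T assms(1) f])
  qed
next
  assume R: ?R
  obtain \<phi> :: "real \<Rightarrow> 'z" where \<phi>: "inj \<phi>"
    using assms(4) by (auto simp: lepoll_def)
  obtain y where y: "T y \<in> U" using assms(2) by blast
  show "compact_operator T"
  proof (rule ccontr)
    assume "\<not> compact_operator T"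
    then obtain f where f: "range f \<subseteq> range \<phi>" "locally_lipschitz (real_copy \<phi>) U f"
      "gateaux_differentiable_at (real_copy \<phi>) f (T y)"
      "\<not> frechet_differentiable_at (real_copy \<phi>) (f \<circ> T) y"
      using not_compact_operator_counterexample[OF assms(3) _ \<phi>] by blast
    have "f \<in> U \<rightarrow> carrier (real_copy \<phi>)" using f(1) by auto
    then show False
      using R banach_space_real_copy[OF \<phi>] f y by blast
  qed
qed

end
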